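(* Let $G$ be a bipartite graph with $m$ left vertices and $n$ right vertices, and let $G^*$ be the bipartite graph obtained from $G$ by swapping its left and right vertex sets. Write $Q_G:=Q_G(1,\dots,1)\subset\mathbb R^n$ and $Q_{G^*}:=Q_{G^*}(1,\dots,1)\subset\mathbb R^m$. Then $$|Q_G\cap\mathbb Z^n|=|Q_{G^*}\cap\mathbb Z^m|.$$ More strongly, the two polytopes have the same distribution of the number of nonzero coordinates of lattice points: $$\sum_{\boldsymbol x\in Q_G\cap\mathbb Z^n}u^{s(\boldsymbol x)}=\sum_{\boldsymbol y\in Q_{G^*}\cap\mathbb Z^m}u^{s(\boldsymbol y)}.$$
   Context: For a bipartite graph $G$ with left vertices $\ell_1,\dots,\ell_m$ and right vertices $r_1,\dots,r_n$, let $I_j=\{i\in[n]\mid\ell_j\text{ is adjacent to }r_i\}$ for $j\in[m]$. For nonempty $I\subset[n]$, $\diamondsuit_I=\operatorname{conv}(\pm\boldsymbol e_i\mid i\in I)\subset\mathbb R^n$ is the cross polytope, and $\diamondsuit_\varnothing=\{\boldsymbol 0\}$. $Q_G(k_1,\dots,k_m)=k_1\diamondsuit_{I_1}+\cdots+k_m\diamondsuit_{I_m}$ (Minkowski sum). For an integer vector $\boldsymbol x$, $s(\boldsymbol x)$ is the number of nonzero coordinates of $\boldsymbol x$; $u$ is an indeterminate. *)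

theory Defs
  imports
    "HOL-Analysis.Analysis"
    "HOL-Library.Set_Algebras"
    "HOL-Computational_Algebra.Polynomial"
begin

text \<open>
  A bipartite graph with left vertex set \<^typ>\<open>'m\<close> and right vertex set \<^typ>\<open>'n\<close> is given by its
  set of edges, each written as a pair (left vertex, right vertex). Swapping the two sides of
  the graph is then the relational \<^const>\<open>converse\<close>. Isolated vertices are allowed on either side.
\<close>

type_synonym ('m, 'n) bigraph = "('m \<times> 'n) set"

definition nbrs :: "('m, 'n) bigraph \<Rightarrow> 'm \<Rightarrow> 'n set"
  where "nbrs G j = {i. (j, i) \<in> G}"

definition cross_polytope :: "'n::finite set \<Rightarrow> (real ^ 'n) set"
  where "cross_polytope I =
    (if I = {} then {0}
     else convex hull ((\<lambda>i. axis i 1) ` I \<union> (\<lambda>i. - axis i 1) ` I))"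

text \<open>
  The sum over the left vertices is the Minkowski sum of sets, provided by
  \<^theory>\<open>HOL-Library.Set_Algebras\<close>.
\<close>

definition Q_poly :: "('m::finite, 'n::finite) bigraph \<Rightarrow> ('m \<Rightarrow> nat) \<Rightarrow> (real ^ 'n) set"
  where "Q_poly G k = (\<Sum>j\<in>UNIV. (\<lambda>x. real (k j) *\<^sub>R x) ` cross_polytope (nbrs G j))"

definition int_lattice :: "(real ^ 'n::finite) set"
  where "int_lattice = {x. \<forall>i. x $ i \<in> \<int>}"

definition supp_size :: "real ^ 'n::finite \<Rightarrow> nat"
  where "supp_size x = card {i. x $ i \<noteq> 0}"

text \<open>
  The generating polynomial of \<^const>\<open>supp_size\<close> over a set of points, in the indeterminate
  \<open>u = monom 1 1\<close>. Both \<^const>\<open>card\<close> and \<^const>\<open>sum\<close> are only meaningful on finite sets; see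
  the finiteness lemma below for the sets of lattice points considered here.
\<close>

definition supp_gen_poly :: "(real ^ 'n::finite) set \<Rightarrow> int poly"
  where "supp_gen_poly A = (\<Sum>x\<in>A. monom 1 1 ^ supp_size x)"

lemma bounded_cross_polytope: "bounded (cross_polytope I)"
  unfolding cross_polytope_def
  by (simp add: bounded_convex_hull finite_imp_bounded)

lemma bounded_Minkowski_sum:
  fixes S :: "'a \<Rightarrow> 'b::real_normed_vector set"
  assumes "finite J" and "\<And>j. j \<in> J \<Longrightarrow> bounded (S j)"
  shows "bounded (\<Sum>j\<in>J. S j)"
  using assms
proof (induction J rule: finite_induct)
  case empty
  then show ?case by (simp add: set_zero)
next
  case (insert a J)
  have "bounded (S a)" "bounded (\<Sum>j\<in>J. S j)"
    using insert by auto
  then have "bounded (\<Union>x\<in>S a. \<Union>y\<in>(\<Sum>j\<in>J. S j). {x + y})"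
    by (rule bounded_sums)
  moreover have "S a + (\<Sum>j\<in>J. S j) = (\<Union>x\<in>S a. \<Union>y\<in>(\<Sum>j\<in>J. S j). {x + y})"
    by (auto simp: set_plus_def)
  ultimately show ?case using insert by simp
qed

lemma bounded_Q_poly: "bounded (Q_poly G k)"
  unfolding Q_poly_def
  by (intro bounded_Minkowski_sum bounded_scaling bounded_cross_polytope) simp

lemma finite_Q_poly_int_lattice: "finite (Q_poly G k \<inter> int_lattice)"
proof -
  obtain B where B: "\<And>x. x \<in> Q_poly G k \<Longrightarrow> norm x \<le> B"
    using bounded_Q_poly[of G k] by (auto simp: bounded_iff)
  define F where "F = {z::real. z \<in> \<int> \<and> \<bar>z\<bar> \<le> B}"
  have "finite F"
    unfolding F_def by (rule finite_abs_int_segment)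
  have "Q_poly G k \<inter> int_lattice \<subseteq> (\<lambda>f. \<chi> i. f i) ` (UNIV \<rightarrow>\<^sub>E F)"
  proof
    fix x assume x: "x \<in> Q_poly G k \<inter> int_lattice"
    then have "x $ i \<in> F" for i
      using B[of x] component_le_norm_cart[of x i] by (auto simp: F_def int_lattice_def)
    then have "(\<lambda>i. x $ i) \<in> UNIV \<rightarrow>\<^sub>E F" by auto
    moreover have "x = (\<chi> i. x $ i)" by simp
    ultimately show "x \<in> (\<lambda>f. \<chi> i. f i) ` (UNIV \<rightarrow>\<^sub>E F)" by blast
  qed
  moreover have "finite ((\<lambda>f. \<chi> i. f i) ` (UNIV \<rightarrow>\<^sub>E F))"
    using \<open>finite F\<close> by (intro finite_imageI finite_PiE) auto
  ultimately show ?thesis by (rule finite_subset)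
qed

end

theory Submission
  imports Defs "HOL-Library.Function_Algebras"
begin

text \<open>
  By the integrality of sums of polymatroids, an integer point \<open>x\<close> lies in \<open>Q_G\<close> iff \<open>\<bar>x\<bar>\<close> is the load vector of a partial
  assignment of left vertices to adjacent right vertices, and \<open>x\<close> is recovered from \<open>\<bar>x\<bar>\<close> by
  \<open>2 ^ s(x)\<close> choices of signs. It remains to see that \<open>G\<close> and its converse have equally many load
  vectors with support of size \<open>s\<close>.

  For the total number, take generic affine forms \<open>l\<^sub>j\<^sub>,\<^sub>k\<close> in the variables \<open>x\<^sub>i\<close> with \<open>i\<close> adjacent to
  \<open>j\<close>, and for each load vector \<open>b\<close> of the converse let \<open>P\<^sub>b\<close> be the product of the \<open>l\<^sub>j\<^sub>,\<^sub>k\<close> with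
  \<open>k = b\<^sub>j\<close>. As \<open>b\<close> comes from a matching, the equations \<open>l\<^sub>j\<^sub>,\<^sub>k = 0\<close> for \<open>k < b\<^sub>j\<close> have a common solution \<open>q\<^sub>b\<close>
  with \<open>P\<^sub>b(q\<^sub>b) \<noteq> 0\<close>, whereas \<open>P\<^sub>c(q\<^sub>b) = 0\<close> unless \<open>b \<le> c\<close>. Hence the \<open>P\<^sub>b\<close> are linearly independent;
  they lie in the span of the monomials whose exponents are load vectors of \<open>G\<close>. This gives one
  inequality, and exchanging the roles of the two sides gives the other.

  For the refinement, apply this to the induced subgraphs on \<open>K\<close> and \<open>S\<close> and let \<open>D(K, S)\<close> be the
  double Moebius inverse of the common count. A load vector with support \<open>S\<close> needs at least
  \<open>card S\<close> assigned vertices, so \<open>D(K, S) = 0\<close> for \<open>card K < card S\<close>, and dually for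
  \<open>card S < card K\<close>. The number of load vectors with support of size \<open>s\<close> is thus, on either side,
  the sum of \<open>D(K, S)\<close> over all \<open>K\<close> and \<open>S\<close> of size \<open>s\<close>.
\<close>

section \<open>Load vectors and affine forms\<close>

text \<open>\<open>None\<close> marks an unassigned left vertex; it corresponds to the constant term
  of an affine form and to the origin of a cross polytope.\<close>

definition loads :: "('m::finite, 'n::finite) bigraph \<Rightarrow> ('n \<Rightarrow> nat) set"
  where "loads G = (\<lambda>\<phi> i. card {j. \<phi> j = Some i}) ` {\<phi>. \<forall>j i. \<phi> j = Some i \<longrightarrow> (j, i) \<in> G}"

lemma finite_loads: "finite (loads G)"
  unfolding loads_def by simp

lemma loadsI: "(\<And>j i. \<phi> j = Some i \<Longrightarrow> (j, i) \<in> G) \<Longrightarrow> (\<lambda>i. card {j. \<phi> j = Some i}) \<in> loads G"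
  unfolding loads_def by auto

lemma loadsE:
  assumes "a \<in> loads G"
  obtains \<phi> where "\<And>j i. \<phi> j = Some i \<Longrightarrow> (j, i) \<in> G" "\<And>i. a i = card {j. \<phi> j = Some i}"
  using assms unfolding loads_def by auto

text \<open>
  \<open>p j k\<close> is the \<open>k\<close>-th coefficient vector for the left vertex \<open>j\<close>; its entry at \<^const>\<open>None\<close> is the
  constant term.
\<close>

definition aform :: "('m, 'n) bigraph \<Rightarrow> ('m \<Rightarrow> nat \<Rightarrow> 'n option \<Rightarrow> real) \<Rightarrow> 'm \<Rightarrow> nat \<Rightarrow> ('n::finite \<Rightarrow> real) \<Rightarrow> real"
  where "aform G p j k x = p j k None + (\<Sum>i\<in>nbrs G j. p j k (Some i) * x i)"

section \<open>Generic coefficients\<close>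

lemma finite_zeros_real_polynomial_function:
  fixes f :: "real \<Rightarrow> real"
  assumes "real_polynomial_function f" "f t0 \<noteq> 0"
  shows "finite {t. f t = 0}"
proof -
  obtain a n where f: "f = (\<lambda>x. \<Sum>i\<le>n. a i * x ^ i)"
    using real_polynomial_function_imp_sum[OF assms(1)] by auto
  then have "\<exists>i\<le>n. a i \<noteq> 0" using assms(2) by (metis (no_types, lifting) atMost_iff mult_eq_0_iff sum.neutral)
  then show ?thesis unfolding f using polyfun_finite_roots[of a n] by simp
qed

text \<open>On the line from a point where no function indexed by \<open>B\<close> vanishes
  (\<open>t = 0\<close>) to a point where \<open>D b\<close> does not vanish (\<open>t = 1\<close>),
  each function is a nonzero polynomial in \<open>t\<close>. Only finitely many \<open>t\<close> are
  zeros, so some \<open>t\<close> avoids them all.\<close>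

lemma common_nonzero:
  fixes D :: "'b \<Rightarrow> ('m \<Rightarrow> nat \<Rightarrow> 'o \<Rightarrow> real) \<Rightarrow> real"
  assumes "finite B"
    and nz: "\<And>b. b \<in> B \<Longrightarrow> \<exists>p. D b p \<noteq> 0"
    and poly: "\<And>b p p'. b \<in> B \<Longrightarrow>
      real_polynomial_function (\<lambda>t. D b (\<lambda>j k o'. p j k o' + t * (p' j k o' - p j k o')))"
  shows "\<exists>p. \<forall>b\<in>B. D b p \<noteq> 0"
  using assms
proof (induction B rule: finite_induct)
  case empty
  then show ?case by simp
next
  case (insert b B)
  have "\<exists>p. \<forall>b\<in>B. D b p \<noteq> 0" using insert.prems by (intro insert.IH) auto
  then obtain p where p: "\<And>b. b \<in> B \<Longrightarrow> D b p \<noteq> 0" by blast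
  obtain p' where p': "D b p' \<noteq> 0" using insert.prems(1)[of b] by blast
  define f where "f c t = D c (\<lambda>j k o'. p j k o' + t * (p' j k o' - p j k o'))" for c t
  have "finite {t. f c t = 0}" if "c \<in> insert b B" for c
  proof (rule finite_zeros_real_polynomial_function)
    show "real_polynomial_function (f c)"
      using insert.prems(2)[OF that] unfolding f_def .
    show "f c (if c = b then 1 else 0) \<noteq> 0"
      using p p' that by (auto simp: f_def)
  qed
  then have "finite (\<Union>c\<in>insert b B. {t. f c t = 0})"
    using insert.hyps by blast
  then obtain t where "t \<notin> (\<Union>c\<in>insert b B. {t. f c t = 0})"
    using ex_new_if_finite[OF infinite_UNIV_char_0] by blast
  then show ?case unfolding f_def by blast
qed

lemma real_polynomial_function_det:
  fixes A :: "real \<Rightarrow> real ^ 'n ^ 'n::finite"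
  assumes "\<And>i j. real_polynomial_function (\<lambda>t. A t $ i $ j)"
  shows "real_polynomial_function (\<lambda>t. det (A t))"
  unfolding det_def using assms by (intro real_polynomial_function_sum real_polynomial_function.intros(4)
    real_polynomial_function_prod real_polynomial_function.intros(2)) (auto intro: finite_permutations)

text \<open>A single \<open>p\<close> has to serve all \<open>b\<close>. For each \<open>b\<close> a
  polynomial \<open>D\<close> in the coefficients, not identically zero, certifies by its
  nonvanishing that the point exists; \<open>common_nonzero\<close> combines the finitely many
  certificates.\<close>

lemma generic_points:
  fixes G :: "('m::finite, 'n::finite) bigraph"
  shows "\<exists>p. \<forall>b\<in>loads (G\<inverse>). \<exists>x.
    (\<forall>j. \<forall>k<b j. aform G p j k x = 0) \<and> (\<forall>j. aform G p j (b j) x \<noteq> 0)"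
proof -
  define good where "good b D \<longleftrightarrow> (\<exists>p. D p \<noteq> 0) \<and>
      (\<forall>p p'. real_polynomial_function (\<lambda>t. D (\<lambda>j k o'. p j k o' + t * (p' j k o' - p j k o')))) \<and>
      (\<forall>p. D p \<noteq> 0 \<longrightarrow>
        (\<exists>x. (\<forall>j. \<forall>k<b j. aform G p j k x = 0) \<and> (\<forall>j. aform G p j (b j) x \<noteq> 0)))" for b D
  have "\<exists>D. good b D" if b: "b \<in> loads (G\<inverse>)" for b
  proof -
    obtain \<psi> where \<psi>: "\<And>i j. \<psi> i = Some j \<Longrightarrow> (j, i) \<in> G" "\<And>j. b j = card {i. \<psi> i = Some j}"
      using b by (elim loadsE) (metis converse_iff)
    \<comment> \<open>\<open>h j\<close> numbers the right vertices assigned to \<open>j\<close>, so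
      each equation with index \<open>k < b j\<close> is matched with exactly one of them.\<close>
    have "\<exists>h. bij_betw h {i. \<psi> i = Some j} {..<b j}" for j
      using \<psi>(2)[of j] by (simp add: finite_same_card_bij)
    then obtain h where h: "\<And>j. bij_betw (h j) {i. \<psi> i = Some j} {..<b j}" by metis
    txt \<open>
      A square system for \<open>q\<^sub>b\<close>: row \<open>i\<close> is the equation \<open>l\<^sub>j\<^sub>,\<^sub>k = 0\<close> matched with the right vertex \<open>i\<close>, or
      \<open>x\<^sub>i = 0\<close> if \<open>i\<close> is unmatched. By Cramer's rule \<open>E p j\<close> is \<open>det (A p)\<close> times the value of the form
      \<open>l\<^sub>j\<^sub>,\<^sub>k\<close> with \<open>k = b\<^sub>j\<close> at the solution.
    \<close>
    define A :: "('m \<Rightarrow> nat \<Rightarrow> 'n option \<Rightarrow> real) \<Rightarrow> real ^ 'n ^ 'n" where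
      "A p = (\<chi> i i'. case \<psi> i of None \<Rightarrow> if i' = i then 1 else 0
         | Some j \<Rightarrow> if i' \<in> nbrs G j then p j (h j i) (Some i') else 0)" for p
    define r :: "('m \<Rightarrow> nat \<Rightarrow> 'n option \<Rightarrow> real) \<Rightarrow> real ^ 'n" where
      "r p = (\<chi> i. case \<psi> i of None \<Rightarrow> 0 | Some j \<Rightarrow> - p j (h j i) None)" for p
    define C where "C p i = (\<chi> i1 i2. if i2 = i then r p $ i1 else A p $ i1 $ i2)" for p i
    define E where "E p j = p j (b j) None * det (A p)
      + (\<Sum>i\<in>nbrs G j. p j (b j) (Some i) * det (C p i))" for p j
    \<comment> \<open>The factor \<open>det (A p)\<close> makes the system solvable; the others keep
      the forms with index \<open>b j\<close> from vanishing at the solution.\<close>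
    define D where "D p = det (A p) * (\<Prod>j\<in>UNIV. E p j)" for p
    have "\<exists>x. (\<forall>j. \<forall>k<b j. aform G p j k x = 0) \<and> (\<forall>j. aform G p j (b j) x \<noteq> 0)"
      if "D p \<noteq> 0" for p
    proof -
      have d: "det (A p) \<noteq> 0" and e: "E p j \<noteq> 0" for j using that by (auto simp: D_def)
      define x :: "real ^ 'n" where "x = (\<chi> k. det (C p k) / det (A p))"
      have x: "A p *v x = r p"
        unfolding x_def C_def cramer[OF d] ..
      have "aform G p j k (\<lambda>i. x $ i) = 0" if "k < b j" for j k
      proof -
        have "k \<in> h j ` {i. \<psi> i = Some j}" using h[of j] \<open>k < b j\<close> by (simp add: bij_betw_def)
        then obtain i where i: "\<psi> i = Some j" "h j i = k" by blast
        have "(A p *v x) $ i = - p j k None" using i by (simp add: x r_def)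
        moreover have "(A p *v x) $ i = (\<Sum>i\<in>nbrs G j. p j k (Some i) * x $ i)"
          using i by (simp add: matrix_vector_mult_def A_def if_distrib[of "\<lambda>y. y * _"] sum.If_cases)
        ultimately show ?thesis by (simp add: aform_def)
      qed
      moreover have "aform G p j (b j) (\<lambda>i. x $ i) = E p j / det (A p)" for j
        using d by (simp add: aform_def E_def x_def add_divide_distrib sum_divide_distrib)
      ultimately show ?thesis using d e by (intro exI[of _ "\<lambda>i. x $ i"]) auto
    qed
    moreover have "\<exists>p. D p \<noteq> 0"
    proof -
      \<comment> \<open>With these coefficients each matched equation reads \<open>x i = 0\<close>
        and each form with index \<open>b j\<close> is the constant 1.\<close>
      define p :: "'m \<Rightarrow> nat \<Rightarrow> 'n option \<Rightarrow> real" where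
        "p j k u = (if k < b j
          then (case u of None \<Rightarrow> 0 | Some i \<Rightarrow> if \<psi> i = Some j \<and> h j i = k then 1 else 0)
          else (case u of None \<Rightarrow> 1 | Some i \<Rightarrow> 0))" for j k u
      have hb: "h j i < b j" if "\<psi> i = Some j" for i j
        using h[of j] that unfolding bij_betw_def by auto
      have hi: "h j i = h j i' \<longleftrightarrow> i = i'" if "\<psi> i = Some j" "\<psi> i' = Some j" for i i' j
        using h[of j] that unfolding bij_betw_def inj_on_def by auto
      have "A p = mat 1"
        using hb hi \<psi>(1) by (auto simp: A_def mat_def vec_eq_iff p_def nbrs_def split: option.splits)
      then have "det (A p) = 1" by simp
      moreover have "E p j = 1" for j
        using calculation by (simp add: E_def p_def)
      ultimately have "D p = 1" by (simp add: D_def)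
      then show ?thesis by (intro exI[of _ p]) simp
    qed
    moreover have "real_polynomial_function (\<lambda>t. D (\<lambda>j k o'. p j k o' + t * (p' j k o' - p j k o')))"
      for p p'
    proof -
      define P where "P t j k o' = p j k o' + t * (p' j k o' - p j k o')" for t :: real and j k o'
      have P: "real_polynomial_function (\<lambda>t. P t j k o')" for j k o'
        unfolding P_def by (intro real_polynomial_function.intros(3) real_polynomial_function.intros(4)
          real_polynomial_function.intros(2) real_polynomial_function.intros(1) bounded_linear_ident)
      have A: "real_polynomial_function (\<lambda>t. A (P t) $ i $ i')" for i i'
        using P by (cases "\<psi> i"; cases "i' \<in> nbrs G (the (\<psi> i))") (simp_all add: A_def real_polynomial_function.intros(2))
      have r: "real_polynomial_function (\<lambda>t. r (P t) $ i)" for i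
        using P by (cases "\<psi> i") (simp_all add: r_def real_polynomial_function.intros(2) real_polynomial_function_minus)
      have C: "real_polynomial_function (\<lambda>t. C (P t) i $ i1 $ i2)" for i i1 i2
        using A r by (cases "i2 = i") (simp_all add: C_def)
      have "real_polynomial_function (\<lambda>t. D (P t))"
        unfolding D_def E_def
        by (intro real_polynomial_function.intros(4) real_polynomial_function.intros(3) real_polynomial_function_prod
          real_polynomial_function_sum real_polynomial_function_det A C P finite)
      then show ?thesis unfolding P_def .
    qed
    ultimately have "good b D" unfolding good_def by blast
    then show ?thesis by blast
  qed
  then obtain D where D: "\<And>b. b \<in> loads (G\<inverse>) \<Longrightarrow> good b (D b)" by metis
  have "\<exists>p. \<forall>b\<in>loads (G\<inverse>). D b p \<noteq> 0"
    by (rule common_nonzero) (use D finite_loads in \<open>auto simp: good_def\<close>)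
  then show ?thesis using D unfolding good_def by meson
qed

section \<open>Linear independence and the total number of load vectors\<close>

text \<open>Each factor contributes its constant term or the variable of one neighbour. These
  choices are the partial assignments, and the exponent of the resulting monomial is the load
  vector.\<close>

lemma prod_aform_expand:
  fixes G :: "('m::finite, 'n::finite) bigraph"
  shows "(\<Prod>j\<in>UNIV. aform G p j (k j) x) =
    (\<Sum>\<phi> | \<forall>j i. \<phi> j = Some i \<longrightarrow> (j, i) \<in> G.
      (\<Prod>j\<in>UNIV. p j (k j) (\<phi> j)) * (\<Prod>i\<in>UNIV. x i ^ card {j. \<phi> j = Some i}))"
proof -
  define X where "X = case_option 1 x"
  define W where "W j = insert None (Some ` nbrs G j)" for j
  have X: "(\<Prod>j\<in>UNIV. X (\<phi> j)) = (\<Prod>i\<in>UNIV. x i ^ card {j. \<phi> j = Some i})"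
    for \<phi> :: "'m \<Rightarrow> 'n option"
  proof -
    have "(\<Prod>j\<in>UNIV. X (\<phi> j)) = (\<Prod>u\<in>UNIV. \<Prod>j | \<phi> j = u. X (\<phi> j))"
      using prod.group[of UNIV UNIV \<phi> "\<lambda>j. X (\<phi> j)"] by simp
    also have "\<dots> = (\<Prod>u\<in>UNIV. X u ^ card {j. \<phi> j = u})"
      by simp
    also have "\<dots> = (\<Prod>i\<in>UNIV. x i ^ card {j. \<phi> j = Some i})"
      by (simp add: UNIV_option_conv prod.reindex X_def)
    finally show ?thesis .
  qed
  have "aform G p j k x = (\<Sum>u\<in>W j. p j k u * X u)" for j k
    unfolding W_def by (subst sum.insert) (auto simp: aform_def X_def sum.reindex)
  then have "(\<Prod>j\<in>UNIV. aform G p j (k j) x) = (\<Prod>j\<in>UNIV. \<Sum>u\<in>W j. p j (k j) u * X u)"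
    by simp
  also have "\<dots> = (\<Sum>\<phi>\<in>PiE UNIV W. \<Prod>j\<in>UNIV. p j (k j) (\<phi> j) * X (\<phi> j))"
    by (rule prod_sum_PiE) auto
  also have "PiE UNIV W = {\<phi>. \<forall>j i. \<phi> j = Some i \<longrightarrow> (j, i) \<in> G}"
  proof (intro set_eqI)
    fix \<phi> :: "'m \<Rightarrow> 'n option"
    have "\<phi> j \<in> W j \<longleftrightarrow> (\<forall>i. \<phi> j = Some i \<longrightarrow> (j, i) \<in> G)" for j
      by (cases "\<phi> j") (auto simp: W_def nbrs_def)
    then show "\<phi> \<in> PiE UNIV W \<longleftrightarrow> \<phi> \<in> {\<phi>. \<forall>j i. \<phi> j = Some i \<longrightarrow> (j, i) \<in> G}"
      by (auto simp: PiE_UNIV_domain)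
  qed
  finally show ?thesis by (simp add: prod.distrib X)
qed

lemma card_loads_le:
  fixes G :: "('m::finite, 'n::finite) bigraph"
  shows "card (loads (G\<inverse>)) \<le> card (loads G)"
proof -
  interpret fv: vector_space "\<lambda>c (f :: ('n \<Rightarrow> real) \<Rightarrow> real) x. c * f x"
    by unfold_locales (auto simp: fun_eq_iff algebra_simps)
  obtain p where "\<forall>b\<in>loads (G\<inverse>). \<exists>x.
      (\<forall>j. \<forall>k<b j. aform G p j k x = 0) \<and> (\<forall>j. aform G p j (b j) x \<noteq> 0)"
    using generic_points by blast
  then obtain q where q0: "\<And>b j k. b \<in> loads (G\<inverse>) \<Longrightarrow> k < b j \<Longrightarrow> aform G p j k (q b) = 0"
    and q1: "\<And>b j. b \<in> loads (G\<inverse>) \<Longrightarrow> aform G p j (b j) (q b) \<noteq> 0"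
    by metis
  define P where "P b x = (\<Prod>j\<in>UNIV. aform G p j (b j) x)" for b x
  have diag: "P b (q b) \<noteq> 0" if "b \<in> loads (G\<inverse>)" for b
    using q1[OF that] by (simp add: P_def)
  have tri: "b \<le> c" if "b \<in> loads (G\<inverse>)" "P c (q b) \<noteq> 0" for b c
  proof (rule le_funI, rule ccontr)
    \<comment> \<open>As \<open>c j < b j\<close>, the factor of \<open>P c\<close> at
      \<open>j\<close> is one of the forms that vanish at \<open>q b\<close>.\<close>
    fix j assume "\<not> b j \<le> c j"
    then have "aform G p j (c j) (q b) = 0" using q0[OF that(1)] by simp
    then have "P c (q b) = 0" unfolding P_def by (intro prod_zero) auto
    with that(2) show False by simp
  qed
  have inj: "inj_on P (loads (G\<inverse>))"
  proof (intro inj_onI)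
    fix b c assume *: "b \<in> loads (G\<inverse>)" "c \<in> loads (G\<inverse>)" "P b = P c"
    show "b = c" using tri[OF *(1), of c] tri[OF *(2), of b] diag[OF *(1)] diag[OF *(2)] *(3)
      by (intro antisym) simp_all
  qed
  define mon where "mon a x = (\<Prod>i\<in>UNIV. x i ^ a i)" for a :: "'n \<Rightarrow> nat" and x :: "'n \<Rightarrow> real"
  have sum_apply: "(\<Sum>i\<in>I. f i) x = (\<Sum>i\<in>I. f i x)" 
    for I :: "'i set" and f :: "'i \<Rightarrow> ('n \<Rightarrow> real) \<Rightarrow> real" and x
    by (induction I rule: infinite_finite_induct) auto
  have "P b \<in> fv.span (mon ` loads G)" for b
  proof -
    have "P b = (\<Sum>\<phi> | \<forall>j i. \<phi> j = Some i \<longrightarrow> (j, i) \<in> G.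
      (\<lambda>x. (\<Prod>j\<in>UNIV. p j (b j) (\<phi> j)) * mon (\<lambda>i. card {j. \<phi> j = Some i}) x))"
      by (rule ext) (simp add: P_def prod_aform_expand mon_def sum_apply)
    also have "\<dots> \<in> fv.span (mon ` loads G)"
      by (intro fv.span_sum fv.span_scale fv.span_base imageI loadsI) auto
    finally show ?thesis .
  qed
  then have span: "P ` loads (G\<inverse>) \<subseteq> fv.span (mon ` loads G)" by auto
  have "fv.independent (P ` loads (G\<inverse>))"
  proof
    assume "fv.dependent (P ` loads (G\<inverse>))"
    then obtain u where u: "\<exists>v\<in>P ` loads (G\<inverse>). u v \<noteq> 0"
      "(\<Sum>v\<in>P ` loads (G\<inverse>). (\<lambda>x. u v * v x)) = 0"
      using fv.dependent_finite[of "P ` loads (G\<inverse>)"] finite_loads by auto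
    define S where "S = {b \<in> loads (G\<inverse>). u (P b) \<noteq> 0}"
    have "finite S" "S \<noteq> {}" using u(1) by (auto simp: S_def finite_loads)
    \<comment> \<open>Evaluation at \<open>q b\<close> for a maximal \<open>b\<close> isolates one
      coefficient: by \<open>tri\<close> another term could survive only if its index lies above
      \<open>b\<close>, where the coefficients are zero.\<close>
    then obtain b where b: "b \<in> S" "\<And>c. c \<in> S \<Longrightarrow> b \<le> c \<Longrightarrow> b = c"
      using finite_has_maximal[of S] by metis
    have bl: "b \<in> loads (G\<inverse>)" using b by (auto simp: S_def)
    have "0 = (\<Sum>v\<in>P ` loads (G\<inverse>). (\<lambda>x. u v * v x)) (q b)" by (simp add: u(2))
    also have "\<dots> = (\<Sum>c\<in>loads (G\<inverse>). u (P c) * P c (q b))"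
      by (simp add: sum_apply sum.reindex[OF inj])
    also have "\<dots> = (\<Sum>c\<in>{b}. u (P c) * P c (q b))"
      using b(2) tri[OF bl] bl by (intro sum.mono_neutral_right finite_loads) (auto simp: S_def)
    also have "\<dots> \<noteq> 0" using b(1) diag[OF bl] by (simp add: S_def)
    finally show False by simp
  qed
  then have "card (P ` loads (G\<inverse>)) \<le> card (mon ` loads G)"
    using fv.independent_span_bound[OF _ _ span] finite_loads by blast
  also have "\<dots> \<le> card (loads G)" by (rule card_image_le[OF finite_loads])
  finally show ?thesis by (simp add: card_image[OF inj])
qed

lemma card_loads_converse:
  fixes G :: "('m::finite, 'n::finite) bigraph"
  shows "card (loads (G\<inverse>)) = card (loads G)"
  using card_loads_le[of G] card_loads_le[of "G\<inverse>"] by simp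

section \<open>Double Moebius inversion\<close>

lemma sum_over_card_eq_if_double_Mobius:
  fixes \<alpha> \<beta> :: "'m::finite set \<Rightarrow> 'n::finite set \<Rightarrow> int"
  assumes eq: "\<And>K S. (\<Sum>T\<in>Pow S. \<alpha> K T) = (\<Sum>L\<in>Pow K. \<beta> L S)"
    and \<alpha>0: "\<And>K S. card K < card S \<Longrightarrow> \<alpha> K S = 0"
    and \<beta>0: "\<And>K S. card S < card K \<Longrightarrow> \<beta> K S = 0"
  shows "(\<Sum>S | card S = s. \<alpha> UNIV S) = (\<Sum>K | card K = s. \<beta> K UNIV)"
proof -
  \<comment> \<open>Up to the sign \<open>(-1) ^ card S\<close> this is the double Moebius inverse
    of the common value in \<open>eq\<close>, since \<beta> already is its inverse in
    \<open>K\<close>. With this sign, inversion in \<open>S\<close> is an involution.\<close>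
  define D where "D K S = (\<Sum>T\<in>Pow S. (-1) ^ card T * \<beta> K T)" for K S
  have \<beta>: "\<beta> K S = (\<Sum>T\<in>Pow S. (-1) ^ card T * D K T)" for K S
    by (rule inclusion_exclusion_symmetric) (auto simp: D_def)
  have \<alpha>: "(-1) ^ card S * \<alpha> K S = (\<Sum>L\<in>Pow K. D L S)" for K S
  proof -
    have "(-1) ^ card S * \<alpha> K S = (\<Sum>T\<in>Pow S. (-1) ^ card T * (\<Sum>L\<in>Pow K. \<beta> L T))"
    proof (rule inclusion_exclusion_symmetric)
      show "(\<Sum>L\<in>Pow K. \<beta> L S) = (\<Sum>T\<in>Pow S. (- 1) ^ card T * ((- 1) ^ card T * \<alpha> K T))" for S
        by (simp add: eq[symmetric] mult.assoc[symmetric] flip: power_add)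
    qed simp
    also have "\<dots> = (\<Sum>L\<in>Pow K. D L S)"
      unfolding D_def sum_distrib_left by (rule sum.swap)
    finally show ?thesis .
  qed
  have D0: "D K S = 0" if "card S < card K" for K S
    unfolding D_def
  proof (intro sum.neutral ballI)
    fix T assume "T \<in> Pow S"
    then have "card T \<le> card S" by (simp add: card_mono)
    then show "(-1) ^ card T * \<beta> K T = 0" using that \<beta>0 by simp
  qed
  \<comment> \<open>The vanishing of \<alpha> only controls the sum of \<open>D L S\<close> over
    \<open>L\<close> in \<open>Pow K\<close>; induction on \<open>card K\<close> removes the terms
    of proper subsets.\<close>
  have D1: "D K S = 0" if "card K < card S" for K S
    using that
  proof (induction "card K" arbitrary: K rule: less_induct)
    case less
    have "D L S = 0" if "L \<in> Pow K - {K}" for L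
    proof (rule less.hyps)
      show "card L < card K" using that by (intro psubset_card_mono) auto
      then show "card L < card S" using less.prems by simp
    qed
    then have "(\<Sum>L\<in>Pow K. D L S) = D K S"
      by (subst sum.remove[of _ K]) auto
    then show ?case using \<alpha>[of S K] \<alpha>0[OF less.prems] by simp
  qed
  have "\<alpha> K S = (-1) ^ card S * (\<Sum>L\<in>Pow K. D L S)" for K S
    by (simp add: \<alpha>[symmetric] mult.assoc[symmetric] flip: power_add)
  then have "(\<Sum>S | card S = s. \<alpha> UNIV S) = (\<Sum>S | card S = s. (-1) ^ s * (\<Sum>L\<in>UNIV. D L S))"
    by simp
  also have "\<dots> = (\<Sum>S | card S = s. (-1) ^ s * (\<Sum>L | card L = s. D L S))"
  proof (rule sum.cong)
    fix S :: "'n set" assume S: "S \<in> {S. card S = s}"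
    have "(\<Sum>L\<in>UNIV. D L S) = (\<Sum>L | card L = s. D L S)"
    proof (intro sum.mono_neutral_right ballI)
      fix L assume "L \<in> UNIV - {L :: 'm set. card L = s}"
      then show "D L S = 0"
        using S D0[of S L] D1[of L S] by (cases "card L" "card S" rule: linorder_cases) auto
    qed auto
    then show "(-1) ^ s * (\<Sum>L\<in>UNIV. D L S) = (-1) ^ s * (\<Sum>L | card L = s. D L S)" by simp
  qed simp
  also have "\<dots> = (\<Sum>L | card L = s. \<Sum>S | card S = s. (-1) ^ s * D L S)"
    unfolding sum_distrib_left by (rule sum.swap)
  also have "\<dots> = (\<Sum>L | card L = s. \<beta> L UNIV)"
  proof (intro sum.cong refl)
    fix L :: "'m set" assume L: "L \<in> {L. card L = s}"
    have "\<beta> L UNIV = (\<Sum>S\<in>UNIV. (-1) ^ card S * D L S)" by (simp add: \<beta>)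
    also have "\<dots> = (\<Sum>S | card S = s. (-1) ^ card S * D L S)"
    proof (intro sum.mono_neutral_right ballI)
      fix S assume "S \<in> UNIV - {S :: 'n set. card S = s}"
      then show "(-1) ^ card S * D L S = 0"
        using L D0[of S L] D1[of L S] by (cases "card L" "card S" rule: linorder_cases) auto
    qed auto
    finally show "(\<Sum>S | card S = s. (-1) ^ s * D L S) = \<beta> L UNIV" by simp
  qed
  finally show ?thesis .
qed

section \<open>Load vectors sorted by support\<close>

abbreviation supp :: "('n \<Rightarrow> nat) \<Rightarrow> 'n set" where "supp a \<equiv> {i. a i \<noteq> 0}"

lemma loads_mono: "G \<subseteq> H \<Longrightarrow> loads G \<subseteq> loads H"
  by (auto simp: loads_def)

lemma load_nonzero:
  fixes \<phi> :: "'m::finite \<Rightarrow> 'n option"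
  shows "card {j. \<phi> j = Some i} \<noteq> 0 \<longleftrightarrow> (\<exists>j. \<phi> j = Some i)"
  by auto

text \<open>The support consists of exactly the right vertices that the assignment uses. Hence the
  summands in \<open>card_loads_supp_sum\<close> depend on \<open>T\<close> but not on
  \<open>S\<close>, as Moebius inversion requires.\<close>

lemma loads_restrict_supp:
  fixes G :: "('m::finite, 'n::finite) bigraph"
  assumes "T \<subseteq> S"
  shows "{a \<in> loads (G \<inter> K \<times> S). supp a = T} = {a \<in> loads (G \<inter> K \<times> T). supp a = T}"
proof (rule Collect_cong)
  fix a
  have "a \<in> loads (G \<inter> K \<times> S) \<longleftrightarrow> a \<in> loads (G \<inter> K \<times> T)" if T: "supp a = T"
  proof
    assume "a \<in> loads (G \<inter> K \<times> S)"
    then obtain \<phi> where \<phi>: "\<And>j i. \<phi> j = Some i \<Longrightarrow> (j, i) \<in> G \<inter> K \<times> S"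
      "\<And>i. a i = card {j. \<phi> j = Some i}" by (elim loadsE) blast
    then have a: "a = (\<lambda>i. card {j. \<phi> j = Some i})" by auto
    have "i \<in> T" if "\<phi> j = Some i" for i j using that T[symmetric] unfolding a load_nonzero by blast
    then show "a \<in> loads (G \<inter> K \<times> T)" unfolding a using \<phi>(1) by (intro loadsI) blast
  next
    assume "a \<in> loads (G \<inter> K \<times> T)"
    then show "a \<in> loads (G \<inter> K \<times> S)"
      using loads_mono[of "G \<inter> K \<times> T" "G \<inter> K \<times> S"] assms by blast
  qed
  then show "(a \<in> loads (G \<inter> K \<times> S) \<and> supp a = T) = (a \<in> loads (G \<inter> K \<times> T) \<and> supp a = T)"
    by blast
qed

lemma supp_loads_subset:
  assumes "a \<in> loads (G \<inter> K \<times> S)"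
  shows "supp a \<subseteq> S"
proof -
  obtain \<phi> where \<phi>: "\<And>j i. \<phi> j = Some i \<Longrightarrow> (j, i) \<in> G \<inter> K \<times> S"
    "\<And>i. a i = card {j. \<phi> j = Some i}" using assms by (elim loadsE) blast
  show ?thesis unfolding \<phi>(2) load_nonzero using \<phi>(1) by blast
qed

text \<open>Every point of the support uses up a vertex of \<open>K\<close>. This yields both
  vanishing conditions of \<open>sum_over_card_eq_if_double_Mobius\<close>.\<close>

lemma card_supp_loads_le:
  assumes "a \<in> loads (G \<inter> K \<times> S)"
  shows "card (supp a) \<le> card K"
proof -
  obtain \<phi> where \<phi>: "\<And>j i. \<phi> j = Some i \<Longrightarrow> (j, i) \<in> G \<inter> K \<times> S"
    "\<And>i. a i = card {j. \<phi> j = Some i}" using assms by (elim loadsE) blast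
  have "Some ` supp a \<subseteq> \<phi> ` K"
  proof (intro image_subsetI)
    fix i assume "i \<in> supp a"
    then obtain j where "\<phi> j = Some i" unfolding \<phi>(2) load_nonzero by blast
    then show "Some i \<in> \<phi> ` K" using \<phi>(1)[of j i] by (intro image_eqI[of _ _ j]) auto
  qed
  then have "card (Some ` supp a) \<le> card (\<phi> ` K)" by (intro card_mono) auto
  also have "\<dots> \<le> card K" by (rule card_image_le) simp
  finally show ?thesis by (simp add: card_image)
qed

lemma card_loads_supp_sum:
  fixes G :: "('m::finite, 'n::finite) bigraph"
  shows "card (loads (G \<inter> K \<times> S)) = (\<Sum>T\<in>Pow S. card {a \<in> loads (G \<inter> K \<times> T). supp a = T})"
proof -
  have "card (loads (G \<inter> K \<times> S)) = (\<Sum>T\<in>Pow S. card {a \<in> loads (G \<inter> K \<times> S). supp a = T})"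
    unfolding card_eq_sum
    by (intro sum.group[symmetric] finite_loads finite image_subsetI PowI supp_loads_subset)
  also have "\<dots> = (\<Sum>T\<in>Pow S. card {a \<in> loads (G \<inter> K \<times> T). supp a = T})"
    by (intro sum.cong refl arg_cong[of _ _ card] loads_restrict_supp) auto
  finally show ?thesis .
qed

lemma card_loads_card_supp:
  fixes G :: "('m::finite, 'n::finite) bigraph"
  shows "card {a \<in> loads G. card (supp a) = s} =
    (\<Sum>S | card S = s. card {a \<in> loads (G \<inter> UNIV \<times> S). supp a = S})"
proof -
  have "card {a \<in> loads G. card (supp a) = s} =
      (\<Sum>S | card S = s. card {a \<in> {a \<in> loads G. card (supp a) = s}. supp a = S})"
    unfolding card_eq_sum by (intro sum.group[symmetric]) (auto simp: finite_loads)
  also have "\<dots> = (\<Sum>S | card S = s. card {a \<in> loads (G \<inter> UNIV \<times> S). supp a = S})"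
  proof (intro sum.cong refl)
    fix S :: "'n set" assume "S \<in> {S. card S = s}"
    then have "{a \<in> {a \<in> loads G. card (supp a) = s}. supp a = S} = {a \<in> loads G. supp a = S}"
      by auto
    then show "card {a \<in> {a \<in> loads G. card (supp a) = s}. supp a = S} =
        card {a \<in> loads (G \<inter> UNIV \<times> S). supp a = S}"
      using loads_restrict_supp[of S UNIV G UNIV] by simp
  qed
  finally show ?thesis .
qed

lemma card_loads_card_supp_converse:
  fixes G :: "('m::finite, 'n::finite) bigraph"
  shows "card {a \<in> loads G. card (supp a) = s} = card {b \<in> loads (G\<inverse>). card (supp b) = s}"
proof -
  define \<alpha> where "\<alpha> K S = int (card {a \<in> loads (G \<inter> K \<times> S). supp a = S})" for K S
  define \<beta> where "\<beta> K S = int (card {b \<in> loads (G\<inverse> \<inter> S \<times> K). supp b = K})" for K S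
  have "(\<Sum>S | card S = s. \<alpha> UNIV S) = (\<Sum>K | card K = s. \<beta> K UNIV)"
  proof (rule sum_over_card_eq_if_double_Mobius)
    fix K S
    have "(G \<inter> K \<times> S)\<inverse> = G\<inverse> \<inter> S \<times> K" by auto
    then have "card (loads (G \<inter> K \<times> S)) = card (loads (G\<inverse> \<inter> S \<times> K))"
      using card_loads_converse[of "G \<inter> K \<times> S"] by simp
    then show "(\<Sum>T\<in>Pow S. \<alpha> K T) = (\<Sum>L\<in>Pow K. \<beta> L S)"
      unfolding card_loads_supp_sum \<alpha>_def \<beta>_def by (simp flip: of_nat_sum)
    show "\<alpha> K S = 0" if "card K < card S"
    proof -
      have "{a \<in> loads (G \<inter> K \<times> S). supp a = S} = {}"
      proof -
        have "card S \<le> card K" if "a \<in> loads (G \<inter> K \<times> S)" "supp a = S" for a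
          using card_supp_loads_le[OF that(1)] unfolding that(2) .
        then show ?thesis using that by fastforce
      qed
      then show ?thesis by (simp only: \<alpha>_def card.empty of_nat_0)
    qed
    show "\<beta> K S = 0" if "card S < card K"
    proof -
      have "{b \<in> loads (G\<inverse> \<inter> S \<times> K). supp b = K} = {}"
      proof -
        have "card K \<le> card S" if "b \<in> loads (G\<inverse> \<inter> S \<times> K)" "supp b = K" for b
          using card_supp_loads_le[OF that(1)] unfolding that(2) .
        then show ?thesis using that by fastforce
      qed
      then show ?thesis by (simp only: \<beta>_def card.empty of_nat_0)
    qed
  qed
  then show ?thesis
    unfolding card_loads_card_supp \<alpha>_def \<beta>_def by (simp flip: of_nat_sum)
qed

section \<open>Cross polytopes and integral decomposition in their Minkowski sum\<close>

text \<open>For nonempty \<open>I\<close>, convexity reduces the bound to the vertices, which have a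
  single nonzero coordinate. Summed over the left vertices it becomes the hypothesis of
  \<open>assignment_exists\<close>.\<close>

lemma sum_abs_cross_polytope_le:
  assumes "x \<in> cross_polytope I"
  shows "(\<Sum>i\<in>T. \<bar>x $ i\<bar>) \<le> of_bool (I \<inter> T \<noteq> {})"
proof (cases "I = {}")
  case True
  then show ?thesis using assms by (simp add: cross_polytope_def)
next
  case False
  define V :: "(real ^ 'a) set" where "V = (\<lambda>i. axis i 1) ` I \<union> (\<lambda>i. - axis i 1) ` I"
  define c :: real where "c = of_bool (I \<inter> T \<noteq> {})"
  have "convex {x :: real ^ 'a. (\<Sum>i\<in>T. \<bar>x $ i\<bar>) \<le> c}"
  proof (intro convexI CollectI; elim CollectE)
    fix x y :: "real ^ 'a" and u v :: real
    assume xy: "(\<Sum>i\<in>T. \<bar>x $ i\<bar>) \<le> c" "(\<Sum>i\<in>T. \<bar>y $ i\<bar>) \<le> c"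
      and uv: "0 \<le> u" "0 \<le> v" "u + v = 1"
    have "(\<Sum>i\<in>T. \<bar>(u *\<^sub>R x + v *\<^sub>R y) $ i\<bar>) \<le> (\<Sum>i\<in>T. u * \<bar>x $ i\<bar> + v * \<bar>y $ i\<bar>)"
    proof (rule sum_mono)
      fix i
      show "\<bar>(u *\<^sub>R x + v *\<^sub>R y) $ i\<bar> \<le> u * \<bar>x $ i\<bar> + v * \<bar>y $ i\<bar>"
        using uv abs_triangle_ineq[of "u * x $ i" "v * y $ i"] by (simp add: abs_mult)
    qed
    also have "\<dots> = u * (\<Sum>i\<in>T. \<bar>x $ i\<bar>) + v * (\<Sum>i\<in>T. \<bar>y $ i\<bar>)"
      by (simp add: sum.distrib sum_distrib_left)
    also have "\<dots> \<le> c" using xy uv by (intro convex_bound_le)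
    finally show "(\<Sum>i\<in>T. \<bar>(u *\<^sub>R x + v *\<^sub>R y) $ i\<bar>) \<le> c" .
  qed
  moreover have "V \<subseteq> {x. (\<Sum>i\<in>T. \<bar>x $ i\<bar>) \<le> c}"
  proof -
    have "(\<Sum>k\<in>T. \<bar>axis i (1 :: real) $ k\<bar>) \<le> c" if "i \<in> I" for i
    proof -
      have "(\<Sum>k\<in>T. \<bar>axis i (1 :: real) $ k\<bar>) = (\<Sum>k\<in>T. if k = i then 1 else 0)"
        by (intro sum.cong) (auto simp: axis_def)
      then show ?thesis using that by (auto simp: c_def)
    qed
    then show ?thesis by (auto simp: V_def)
  qed
  ultimately have "convex hull V \<subseteq> {x. (\<Sum>i\<in>T. \<bar>x $ i\<bar>) \<le> c}"
    by (intro hull_minimal)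
  moreover have "x \<in> convex hull V" using assms False by (simp add: cross_polytope_def V_def)
  ultimately show ?thesis unfolding c_def by blast
qed

lemma zero_in_cross_polytope: "0 \<in> cross_polytope I"
proof (cases "I = {}")
  case False
  then obtain i where "i \<in> I" by blast
  then have "axis i 1 \<in> cross_polytope I" "- axis i 1 \<in> cross_polytope I"
    using False by (auto simp: cross_polytope_def intro!: hull_inc)
  moreover have "convex (cross_polytope I)" by (simp add: cross_polytope_def)
  ultimately have "(1/2) *\<^sub>R axis i 1 + (1/2) *\<^sub>R (- axis i 1) \<in> cross_polytope I"
    by (intro convexD) auto
  then show ?thesis by simp
qed (simp add: cross_polytope_def)

lemma mem_Q_poly_one:
  "x \<in> Q_poly G (\<lambda>_. 1) \<longleftrightarrow> (\<exists>s. x = (\<Sum>j\<in>UNIV. s j) \<and> (\<forall>j. s j \<in> cross_polytope (nbrs G j)))"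
proof -
  have "Q_poly G (\<lambda>_. 1) = {sum s UNIV | s. \<forall>j\<in>UNIV. s j \<in> cross_polytope (nbrs G j)}"
    unfolding Q_poly_def by (subst set_sum_alt) simp_all
  then show ?thesis by blast
qed

text \<open>
  The sets violating the inequality for \<open>J\<close> without \<open>j\<close> are closed under intersection, so there is
  a least one \<open>T\<close>; assigning \<open>j\<close> to a neighbour in \<open>T\<close> repairs all of them at once.
\<close>

lemma assignment_exists:
  fixes G :: "('m::finite, 'n::finite) bigraph"
  assumes "finite J" "\<And>T. (\<Sum>i\<in>T. a i) \<le> card {j \<in> J. nbrs G j \<inter> T \<noteq> {}}"
  shows "\<exists>\<phi>. (\<forall>j i. \<phi> j = Some i \<longrightarrow> j \<in> J \<and> (j, i) \<in> G) \<and> (\<forall>i. a i = card {j. \<phi> j = Some i})"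
  using assms
proof (induction J arbitrary: a rule: finite_induct)
  case empty
  have "a i = 0" for i using empty[of "{i}"] by simp
  then show ?case by (intro exI[of _ "\<lambda>_. None"]) auto
next
  case (insert j J)
  define f where "f T = card {j \<in> J. nbrs G j \<inter> T \<noteq> {}}" for T
  have f_insert: "card {l \<in> insert j J. nbrs G l \<inter> T \<noteq> {}} = f T + of_bool (nbrs G j \<inter> T \<noteq> {})" for T
  proof (cases "nbrs G j \<inter> T = {}")
    case True
    then have "{l \<in> insert j J. nbrs G l \<inter> T \<noteq> {}} = {l \<in> J. nbrs G l \<inter> T \<noteq> {}}" by auto
    then show ?thesis using True by (simp add: f_def)
  next
    case False
    then have "{l \<in> insert j J. nbrs G l \<inter> T \<noteq> {}} = insert j {l \<in> J. nbrs G l \<inter> T \<noteq> {}}" by auto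
    then show ?thesis using False insert.hyps by (simp add: f_def)
  qed
  have le: "sum a T \<le> f T + of_bool (nbrs G j \<inter> T \<noteq> {})" for T
    using insert.prems[of T] f_insert[of T] by simp
  show ?case
  proof (cases "\<forall>T. sum a T \<le> f T")
    case True
    then show ?thesis using insert.IH[of a] unfolding f_def by blast
  next
    case False
    define bad where "bad T \<longleftrightarrow> f T < sum a T" for T
    have sub: "f (S \<inter> T) + f (S \<union> T) \<le> f S + f T" for S T
    proof -
      define F where "F T = {j \<in> J. nbrs G j \<inter> T \<noteq> {}}" for T
      have "card (F (S \<inter> T)) \<le> card (F S \<inter> F T)" by (intro card_mono) (auto simp: F_def)
      moreover have "F (S \<union> T) = F S \<union> F T" by (auto simp: F_def)
      moreover have "card (F S) + card (F T) = card (F S \<union> F T) + card (F S \<inter> F T)"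
        by (rule card_Un_Int) auto
      ultimately show ?thesis by (simp add: f_def F_def)
    qed
    \<comment> \<open>Two bad sets exceed \<open>f\<close> by at least two in total, while by
      \<open>le\<close> their union exceeds it by at most one; submodularity leaves an excess on the
      intersection.\<close>
    have bad_Int: "bad (S \<inter> T)" if "bad S" "bad T" for S T
    proof -
      have "sum a (S \<union> T) + sum a (S \<inter> T) = sum a S + sum a T"
        by (rule sum.union_inter) auto
      then show ?thesis using that sub[of S T] le[of "S \<union> T"] unfolding bad_def
        by (auto split: if_splits simp: of_bool_def)
    qed
    obtain T0 where T0: "bad T0" "\<And>T. bad T \<Longrightarrow> card T0 \<le> card T"
      using False ex_has_least_nat[of bad _ card] unfolding bad_def by (metis not_le)
    have least: "T0 \<subseteq> T" if "bad T" for T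
    proof -
      have "card T0 \<le> card (T0 \<inter> T)" using T0 bad_Int that by blast
      then have "T0 \<inter> T = T0" by (intro card_seteq) auto
      then show ?thesis by blast
    qed
    have "nbrs G j \<inter> T0 \<noteq> {}" using T0(1) le[of T0] unfolding bad_def by (cases "nbrs G j \<inter> T0 = {}") auto
    then obtain i where i: "(j, i) \<in> G" "i \<in> T0" by (auto simp: nbrs_def)
    \<comment> \<open>Otherwise removing \<open>i\<close> from \<open>T0\<close> would leave a
      smaller bad set.\<close>
    have ai: "a i \<noteq> 0"
    proof
      assume "a i = 0"
      then have "sum a (T0 - {i}) = sum a T0" using i by (simp add: sum_diff1_nat)
      moreover have "f (T0 - {i}) \<le> f T0" unfolding f_def by (intro card_mono) auto
      ultimately have "bad (T0 - {i})" using T0(1) unfolding bad_def by linarith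
      then show False using least i by blast
    qed
    define a' where "a' = a(i := a i - 1)"
    have a': "a = a'(i := Suc (a' i))" using ai by (auto simp: a'_def)
    have sum_a: "sum a T = sum a' T + of_bool (i \<in> T)" for T
    proof -
      have "a k = a' k + (if k = i then 1 else 0)" for k using ai by (simp add: a'_def)
      then have "sum a T = sum a' T + (\<Sum>k\<in>T. if k = i then 1 else 0)" by (simp add: sum.distrib)
      then show ?thesis by simp
    qed
    \<comment> \<open>A bad set contains \<open>i\<close>, so its sum drops by one, which is all the
      excess that \<open>le\<close> permits.\<close>
    have "sum a' T \<le> f T" for T
    proof (cases "bad T")
      case True
      then have "i \<in> T" using least i by blast
      then show ?thesis using sum_a[of T] le[of T] by (auto simp: of_bool_def split: if_splits)
    next
      case False
      then show ?thesis using sum_a[of T] by (simp add: bad_def)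
    qed
    then obtain \<phi> where \<phi>: "\<And>l i. \<phi> l = Some i \<Longrightarrow> l \<in> J \<and> (l, i) \<in> G" "\<And>i. a' i = card {l. \<phi> l = Some i}"
      using insert.IH[of a'] unfolding f_def by blast
    have "\<phi> j = None" using \<phi>(1)[of j] insert.hyps by (cases "\<phi> j") auto
    define \<psi> where "\<psi> = \<phi>(j := Some i)"
    have "{l. \<psi> l = Some k} = (if k = i then insert j {l. \<phi> l = Some k} else {l. \<phi> l = Some k})" for k
      using \<open>\<phi> j = None\<close> by (auto simp: \<psi>_def)
    then have "card {l. \<psi> l = Some k} = a k" for k
      using \<open>\<phi> j = None\<close> by (subst a') (simp add: \<phi>(2))
    moreover have "l \<in> insert j J \<and> (l, k) \<in> G" if "\<psi> l = Some k" for l k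
      using that \<phi>(1)[of l k] i by (auto simp: \<psi>_def split: if_splits)
    ultimately show ?thesis by (intro exI[of _ \<psi>]) simp
  qed
qed

section \<open>Lattice points, signs and generating polynomials\<close>

text \<open>The floor only serves to land in \<open>nat\<close>: on \<open>int_lattice\<close>
  nothing is rounded.\<close>

definition abs_vec :: "real ^ 'n \<Rightarrow> 'n \<Rightarrow> nat"
  where "abs_vec x i = nat \<lfloor>\<bar>x $ i\<bar>\<rfloor>"

lemma of_nat_abs_vec:
  assumes "x \<in> int_lattice"
  shows "real (abs_vec x i) = \<bar>x $ i\<bar>"
proof -
  have "\<bar>x $ i\<bar> \<in> \<int>" using assms by (simp add: int_lattice_def)
  then show ?thesis by (auto simp: abs_vec_def elim!: Ints_cases)
qed

text \<open>In a decomposition of \<open>x\<close>, the triangle inequality gives the Hall-type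
  condition of \<open>assignment_exists\<close>. Conversely, a left vertex assigned to
  \<open>i\<close> contributes the unit vector of \<open>i\<close> with the sign of
  \<open>x $ i\<close>, so nothing cancels.\<close>

lemma mem_Q_poly_iff_loads:
  fixes G :: "('m::finite, 'n::finite) bigraph"
  assumes x: "x \<in> int_lattice"
  shows "x \<in> Q_poly G (\<lambda>_. 1) \<longleftrightarrow> abs_vec x \<in> loads G"
proof
  assume "x \<in> Q_poly G (\<lambda>_. 1)"
  then obtain s where s: "x = (\<Sum>j\<in>UNIV. s j)" "\<And>j. s j \<in> cross_polytope (nbrs G j)"
    unfolding mem_Q_poly_one by blast
  have "sum (abs_vec x) T \<le> card {j \<in> UNIV. nbrs G j \<inter> T \<noteq> {}}" for T
  proof -
    have "real (sum (abs_vec x) T) = (\<Sum>i\<in>T. \<bar>\<Sum>j\<in>UNIV. s j $ i\<bar>)"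
      by (simp add: of_nat_abs_vec[OF x]) (simp add: s(1))
    also have "\<dots> \<le> (\<Sum>i\<in>T. \<Sum>j\<in>UNIV. \<bar>s j $ i\<bar>)" by (intro sum_mono sum_abs)
    also have "\<dots> = (\<Sum>j\<in>UNIV. \<Sum>i\<in>T. \<bar>s j $ i\<bar>)" by (rule sum.swap)
    also have "\<dots> \<le> (\<Sum>j\<in>UNIV. of_bool (nbrs G j \<inter> T \<noteq> {}))"
      by (intro sum_mono sum_abs_cross_polytope_le s(2))
    also have "\<dots> = real (card {j \<in> UNIV. nbrs G j \<inter> T \<noteq> {}})" by (simp add: of_bool_def sum.If_cases)
    finally show ?thesis by linarith
  qed
  then obtain \<phi> where \<phi>: "\<forall>j i. \<phi> j = Some i \<longrightarrow> (j, i) \<in> G"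
    "\<And>i. abs_vec x i = card {j. \<phi> j = Some i}"
    using assignment_exists[of UNIV "abs_vec x" G] by auto
  then have "abs_vec x = (\<lambda>i. card {j. \<phi> j = Some i})" by auto
  then show "abs_vec x \<in> loads G" using \<phi>(1) by (auto intro: loadsI)
next
  assume "abs_vec x \<in> loads G"
  then obtain \<phi> where \<phi>: "\<And>j i. \<phi> j = Some i \<Longrightarrow> (j, i) \<in> G"
    "\<And>i. abs_vec x i = card {j. \<phi> j = Some i}" by (elim loadsE) blast
  define s :: "'m \<Rightarrow> real ^ 'n" where "s j = (case \<phi> j of None \<Rightarrow> 0 | Some i \<Rightarrow> sgn (x $ i) *\<^sub>R axis i 1)" for j
  have "s j \<in> cross_polytope (nbrs G j)" for j
  proof (cases "\<phi> j")
    case None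
    then show ?thesis by (simp add: s_def zero_in_cross_polytope)
  next
    case (Some i)
    then have i: "i \<in> nbrs G j" using \<phi>(1) by (simp add: nbrs_def)
    then have "axis i 1 \<in> cross_polytope (nbrs G j)" "- axis i 1 \<in> cross_polytope (nbrs G j)"
      by (auto simp: cross_polytope_def intro!: hull_inc)
    then show ?thesis using Some zero_in_cross_polytope[of "nbrs G j"]
      by (cases "x $ i" "0 :: real" rule: linorder_cases) (simp_all add: s_def)
  qed
  moreover have "x = (\<Sum>j\<in>UNIV. s j)"
  proof (rule vec_eq_iff[THEN iffD2], rule allI)
    fix i
    have "s j $ i = (if \<phi> j = Some i then sgn (x $ i) else 0)" for j
      by (auto simp: s_def axis_def split: option.splits)
    then have "(\<Sum>j\<in>UNIV. s j) $ i = real (card {j. \<phi> j = Some i}) * sgn (x $ i)"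
      by (simp add: sum.If_cases)
    also have "\<dots> = x $ i"
      by (simp add: \<phi>(2)[symmetric] of_nat_abs_vec[OF x] abs_mult_sgn)
    finally show "x $ i = (\<Sum>j\<in>UNIV. s j) $ i" ..
  qed
  ultimately show "x \<in> Q_poly G (\<lambda>_. 1)" unfolding mem_Q_poly_one by blast
qed

lemma supp_abs_vec: "x \<in> int_lattice \<Longrightarrow> supp (abs_vec x) = {i. x $ i \<noteq> 0}"
  using of_nat_abs_vec[of x] by (metis abs_eq_0 of_nat_eq_0_iff)

text \<open>A point of the fibre is determined by its set of negative coordinates, which can be any
  subset of the support.\<close>

lemma card_abs_vec_fibre:
  fixes a :: "'n::finite \<Rightarrow> nat"
  shows "card {x \<in> int_lattice. abs_vec x = a} = 2 ^ card (supp a)"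
proof -
  define v :: "'n set \<Rightarrow> real ^ 'n" where "v N = (\<chi> i. if i \<in> N then - real (a i) else real (a i))" for N
  have "bij_betw v (Pow (supp a)) {x \<in> int_lattice. abs_vec x = a}"
  proof (rule bij_betw_byWitness[where f' = "\<lambda>x. {i. x $ i < 0}"])
    show "\<forall>N\<in>Pow (supp a). {i. v N $ i < 0} = N" by (auto simp: v_def split: if_splits)
    show "v ` Pow (supp a) \<subseteq> {x \<in> int_lattice. abs_vec x = a}"
      by (auto simp: v_def int_lattice_def abs_vec_def fun_eq_iff)
    show "(\<lambda>x. {i. x $ i < 0}) ` {x \<in> int_lattice. abs_vec x = a} \<subseteq> Pow (supp a)"
      using supp_abs_vec by fastforce
    show "\<forall>x\<in>{x \<in> int_lattice. abs_vec x = a}. v {i. x $ i < 0} = x"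
      by (auto simp: v_def vec_eq_iff of_nat_abs_vec)
  qed
  then show ?thesis by (simp add: bij_betw_same_card[symmetric] card_Pow)
qed

text \<open>\<open>abs_vec\<close> preserves the number of nonzero coordinates, and its fibres over
  vectors with support of size \<open>s\<close> all have \<open>2 ^ s\<close> points.\<close>

lemma card_supp_size_Q_poly:
  fixes G :: "('m::finite, 'n::finite) bigraph"
  shows "card {x \<in> Q_poly G (\<lambda>_. 1) \<inter> int_lattice. supp_size x = s}
    = card {a \<in> loads G. card (supp a) = s} * 2 ^ s"
proof -
  let ?X = "{x \<in> Q_poly G (\<lambda>_. 1) \<inter> int_lattice. supp_size x = s}"
  let ?A = "{a \<in> loads G. card (supp a) = s}"
  have X: "x \<in> ?X \<longleftrightarrow> x \<in> int_lattice \<and> abs_vec x \<in> ?A" for x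
    using mem_Q_poly_iff_loads[of x G] supp_abs_vec[of x] by (auto simp: supp_size_def)
  have "card ?X = (\<Sum>a\<in>?A. card {x \<in> ?X. abs_vec x = a})"
    unfolding card_eq_sum using X
    by (intro sum.group[symmetric] finite_subset[OF _ finite_Q_poly_int_lattice[of G]]
      finite_subset[OF _ finite_loads[of G]]) auto
  also have "\<dots> = (\<Sum>a\<in>?A. 2 ^ s)"
  proof (rule sum.cong)
    fix a assume a: "a \<in> ?A"
    then have "{x \<in> ?X. abs_vec x = a} = {x \<in> int_lattice. abs_vec x = a}"
      using X by blast
    then show "card {x \<in> ?X. abs_vec x = a} = 2 ^ s" using a by (simp add: card_abs_vec_fibre)
  qed simp
  finally show ?thesis by simp
qed

text \<open>Fibres of equal size mean that \<open>f\<close> and \<open>g\<close> have the same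
  multiset of values.\<close>

lemma sum_eq_if_card_fibres_eq:
  fixes f :: "'a \<Rightarrow> 'c" and g :: "'b \<Rightarrow> 'c" and h :: "'c \<Rightarrow> 'd::comm_monoid_add"
  assumes "finite A" "finite B" and eq: "\<And>c. card {x \<in> A. f x = c} = card {y \<in> B. g y = c}"
  shows "(\<Sum>x\<in>A. h (f x)) = (\<Sum>y\<in>B. h (g y))"
proof -
  have "count (image_mset f (mset_set A)) c = count (image_mset g (mset_set B)) c" for c
  proof -
    have "f -` {c} \<inter> A = {x \<in> A. f x = c}" "g -` {c} \<inter> B = {y \<in> B. g y = c}" by auto
    then show ?thesis using assms by (simp add: count_image_mset)
  qed
  then have "image_mset f (mset_set A) = image_mset g (mset_set B)" by (rule multiset_eqI)
  then have "(\<Sum>c\<in>#image_mset f (mset_set A). h c) = (\<Sum>c\<in>#image_mset g (mset_set B). h c)" by simp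
  then show ?thesis by (simp add: sum_unfold_sum_mset multiset.map_comp o_def)
qed

theorem corollary4p6:
  fixes G :: "('m::finite, 'n::finite) bigraph"
  shows "card (Q_poly G (\<lambda>_. 1) \<inter> int_lattice) = card (Q_poly (G\<inverse>) (\<lambda>_. 1) \<inter> int_lattice) \<and>
    supp_gen_poly (Q_poly G (\<lambda>_. 1) \<inter> int_lattice)
      = supp_gen_poly (Q_poly (G\<inverse>) (\<lambda>_. 1) \<inter> int_lattice)"
proof -
  let ?X = "Q_poly G (\<lambda>_. 1) \<inter> int_lattice" and ?Y = "Q_poly (G\<inverse>) (\<lambda>_. 1) \<inter> int_lattice"
  have "card {x \<in> ?X. supp_size x = s} = card {y \<in> ?Y. supp_size y = s}" for s
    unfolding card_supp_size_Q_poly card_loads_card_supp_converse[of G] ..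
  note eq = sum_eq_if_card_fibres_eq[OF finite_Q_poly_int_lattice finite_Q_poly_int_lattice this]
  \<comment> \<open>The constant 1 as \<open>h\<close> gives the cardinalities, the powers of the
    indeterminate give the polynomials.\<close>
  show ?thesis
    using eq[of "\<lambda>_. 1 :: nat"] eq[of "\<lambda>s. monom 1 1 ^ s :: int poly"] by (simp add: supp_gen_poly_def)
qed

end
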